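(* Let $p$ be a prime, $m\in\mathbb{N}$ with $m\ge 1$, $n=p^m$, $S=\{a\in\mathbb{Z}_n \mid \gcd(a,n)=1\}$, and $\Gamma=\mathrm{Cay}(\mathbb{Z}_n,S)$. Let $v\ge 1$ be an integer and let $K_v$ be the complete graph on $v$ vertices. Then the multicone graph $K_v\bigtriangledown\Gamma$ is DS with respect to its Laplacian spectrum.
   Context: For a finite group $G$ and an inverse-closed subset $H\subseteq G$ not containing the identity, $\mathrm{Cay}(G,H)$ is the simple undirected graph with vertex set $G$ in which $x,y$ are adjacent iff $x^{-1}y\in H$. Here $G=\mathbb{Z}_n$ is the additive cyclic group, so $x,y$ are adjacent iff $y-x\in S$. The join $\Gamma_1\bigtriangledown\Gamma_2$ is obtained from the disjoint union of $\Gamma_1$ and $\Gamma_2$ by joining every vertex of $\Gamma_1$ to every vertex of $\Gamma_2$; a multicone graph is the join of a complete graph and a regular graph. The Laplacian matrix of a finite simple graph is $L=D-A$, where $A$ is the adjacency matrix and $D$ is the diagonal matrix of vertex degrees; the Laplacian spectrum is the multiset of eigenvalues of $L$. A graph is DS with respect to its Laplacian spectrum if every finite simple graph with the same Laplacian spectrum is isomorphic to it. *)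

theory Defs
  imports
    "HOL-Algebra.Elementary_Groups"
    "HOL-Computational_Algebra.Computational_Algebra"
    "Graph_Theory.Graph_Theory"
    "Jordan_Normal_Form.Char_Poly"
begin

text \<open>
  A finite simple graph is a \<^const>\<open>pair_graph\<close>: a finite, symmetric and irreflexive set of
  ordered pairs on a finite vertex set. The degree of a vertex is then its \<^const>\<open>out_degree\<close>.
\<close>

definition cayley_graph :: "('a, 'm) monoid_scheme \<Rightarrow> 'a set \<Rightarrow> 'a pair_pre_digraph" where
  "cayley_graph G H =
    \<lparr> pverts = carrier G,
      parcs = {(x, y). x \<in> carrier G \<and> y \<in> carrier G \<and> inv\<^bsub>G\<^esub> x \<otimes>\<^bsub>G\<^esub> y \<in> H} \<rparr>"

definition graph_join ::
  "'a pair_pre_digraph \<Rightarrow> 'b pair_pre_digraph \<Rightarrow> ('a + 'b) pair_pre_digraph" (infixl \<open>\<nabla>\<close> 65) where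
  "G \<nabla> H =
    \<lparr> pverts = pverts G <+> pverts H,
      parcs = {(Inl x, Inl y) | x y. (x, y) \<in> parcs G}
            \<union> {(Inr x, Inr y) | x y. (x, y) \<in> parcs H}
            \<union> {(Inl x, Inr y) | x y. x \<in> pverts G \<and> y \<in> pverts H}
            \<union> {(Inr y, Inl x) | x y. x \<in> pverts G \<and> y \<in> pverts H} \<rparr>"

text \<open>In the following matrices, row and column \<open>i\<close> belong to the vertex \<open>xs ! i\<close>.\<close>

definition adjacency_mat :: "'a list \<Rightarrow> 'a pair_pre_digraph \<Rightarrow> complex mat" where
  "adjacency_mat xs G =
    mat (length xs) (length xs) (\<lambda>(i, j). if (xs ! i, xs ! j) \<in> parcs G then 1 else 0)"

definition degree_mat :: "'a list \<Rightarrow> 'a pair_pre_digraph \<Rightarrow> complex mat" where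
  "degree_mat xs G =
    mat (length xs) (length xs)
      (\<lambda>(i, j). if i = j then of_nat (out_degree (with_proj G) (xs ! i)) else 0)"

definition laplacian_mat :: "'a list \<Rightarrow> 'a pair_pre_digraph \<Rightarrow> complex mat" where
  "laplacian_mat xs G = degree_mat xs G - adjacency_mat xs G"

text \<open>
  The multiset of eigenvalues is the multiset of roots of the characteristic polynomial. It does not
  depend on the chosen enumeration of the vertices, see \<open>laplacian_spectrum_eq\<close> below.
\<close>

definition laplacian_spectrum :: "'a pair_pre_digraph \<Rightarrow> complex multiset" where
  "laplacian_spectrum G =
    proots (char_poly (laplacian_mat (SOME xs. distinct xs \<and> set xs = pverts G) G))"

text \<open>
  The type argument is the vertex type of the graphs compared with \<open>G\<close>; a statement that is
  polymorphic in it covers all finite simple graphs.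
\<close>

definition DS_laplacian :: "'b itself \<Rightarrow> 'a pair_pre_digraph \<Rightarrow> bool" where
  "DS_laplacian (_ :: 'b itself) G \<longleftrightarrow>
    (\<forall>H :: 'b pair_pre_digraph. pair_graph H \<longrightarrow> laplacian_spectrum H = laplacian_spectrum G \<longrightarrow>
      digraph_iso (with_proj H) (with_proj G))"

lemma similar_mat_reindex:
  fixes g :: "'a \<Rightarrow> 'a \<Rightarrow> 'b :: comm_ring_1"
  assumes "distinct xs" "distinct ys" "set xs = set ys"
  defines "M \<equiv> \<lambda>zs :: 'a list. mat (length zs) (length zs) (\<lambda>(i, j). g (zs ! i) (zs ! j))"
  shows "similar_mat (M xs) (M ys)"
proof -
  define n where "n = length xs"
  have n: "length xs = n" "length ys = n"
    using assms(1-3) distinct_card unfolding n_def by metis+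
  define Q where "Q = (\<lambda>us vs :: 'a list. mat n n (\<lambda>(i, j). if us ! i = vs ! j then 1 else (0 :: 'b)))"
  have pick: "(\<Sum>k<n. if us ! k = x then h (us ! k) else 0) = h x"
    if us: "distinct us" "length us = n" "x \<in> set us" for us x and h :: "'a \<Rightarrow> 'b"
  proof -
    obtain l where l: "l < n" "us ! l = x"
      using us(2,3) by (auto simp: in_set_conv_nth)
    have "(\<Sum>k<n. if us ! k = x then h (us ! k) else 0) = (\<Sum>k<n. if k = l then h x else 0)"
      using us(1,2) l by (intro sum.cong) (auto simp: nth_eq_iff_index_eq)
    then show ?thesis using l by simp
  qed
  have mult: "mat n n (\<lambda>(i, j). a i j) * mat n n (\<lambda>(i, j). b i j)
      = mat n n (\<lambda>(i, j). \<Sum>k<n. a i k * b k j)" for a b :: "nat \<Rightarrow> nat \<Rightarrow> 'b"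
    by (rule eq_matI) (auto simp: scalar_prod_def atLeast0LessThan)
  have mem: "xs ! i \<in> set ys" "ys ! i \<in> set xs" "xs ! i \<in> set xs" "ys ! i \<in> set ys" if "i < n" for i
    using that n nth_mem[of i xs] nth_mem[of i ys] assms(3) by simp_all
  have inv: "Q us vs * Q vs us = 1\<^sub>m n"
    if "distinct us" "distinct vs" "length us = n" "length vs = n" "set us = set vs" for us vs
  proof -
    have "(\<Sum>k<n. (if us ! i = vs ! k then 1 else 0) * (if vs ! k = us ! j then 1 else (0 :: 'b)))
        = (if i = j then 1 else 0)" if ij: "i < n" "j < n" for i j
    proof -
      have "(\<Sum>k<n. (if us ! i = vs ! k then 1 else 0) * (if vs ! k = us ! j then 1 else (0 :: 'b)))
          = (\<Sum>k<n. if vs ! k = us ! i then (if vs ! k = us ! j then 1 else 0) else 0)"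
        by (intro sum.cong) auto
      also have "\<dots> = (if us ! i = us ! j then 1 else 0)"
        using \<open>set us = set vs\<close> \<open>length us = n\<close> ij \<open>distinct vs\<close> \<open>length vs = n\<close> nth_mem[of i us]
        by (subst pick[of vs "us ! i" "\<lambda>z. if z = us ! j then 1 else 0"]) auto
      finally show ?thesis
        using \<open>distinct us\<close> \<open>length us = n\<close> ij by (simp add: nth_eq_iff_index_eq)
    qed
    then show ?thesis
      unfolding Q_def mult by (intro eq_matI) auto
  qed
  have 1: "Q xs ys * M ys = mat n n (\<lambda>(i, j). g (xs ! i) (ys ! j))"
  proof -
    have "(\<Sum>k<n. (if xs ! i = ys ! k then 1 else 0) * g (ys ! k) (ys ! j)) = g (xs ! i) (ys ! j)"
      if "i < n" "j < n" for i j
    proof -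
      have "(\<Sum>k<n. (if xs ! i = ys ! k then 1 else 0) * g (ys ! k) (ys ! j))
          = (\<Sum>k<n. if ys ! k = xs ! i then g (ys ! k) (ys ! j) else 0)"
        by (intro sum.cong) auto
      also have "\<dots> = g (xs ! i) (ys ! j)"
        using mem that n assms(2) by (intro pick[of ys "xs ! i" "\<lambda>z. g z (ys ! j)"]) auto
      finally show ?thesis .
    qed
    then show ?thesis
      unfolding Q_def M_def n mult by (intro eq_matI) auto
  qed
  have 2: "mat n n (\<lambda>(i, j). g (xs ! i) (ys ! j)) * Q ys xs = M xs"
  proof -
    have "(\<Sum>k<n. g (xs ! i) (ys ! k) * (if ys ! k = xs ! j then 1 else 0)) = g (xs ! i) (xs ! j)"
      if "i < n" "j < n" for i j
    proof -
      have "(\<Sum>k<n. g (xs ! i) (ys ! k) * (if ys ! k = xs ! j then 1 else 0))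
          = (\<Sum>k<n. if ys ! k = xs ! j then g (xs ! i) (ys ! k) else 0)"
        by (intro sum.cong) auto
      also have "\<dots> = g (xs ! i) (xs ! j)"
        using mem that n assms(2) by (intro pick[of ys "xs ! j" "\<lambda>z. g (xs ! i) z"]) auto
      finally show ?thesis .
    qed
    then show ?thesis
      unfolding Q_def M_def n mult by (intro eq_matI) auto
  qed
  have "{M xs, M ys, Q xs ys, Q ys xs} \<subseteq> carrier_mat n n"
    by (auto simp: M_def Q_def n)
  moreover have "M xs = Q xs ys * M ys * Q ys xs"
    unfolding 1 2 ..
  moreover have "Q xs ys * Q ys xs = 1\<^sub>m n" "Q ys xs * Q xs ys = 1\<^sub>m n"
    using inv assms(1-3) n by simp_all
  ultimately show ?thesis
    by (intro similar_matI[where P = "Q xs ys" and Q = "Q ys xs"])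
qed

lemma laplacian_mat_conv:
  assumes "distinct xs"
  shows "laplacian_mat xs G = mat (length xs) (length xs) (\<lambda>(i, j).
    (if xs ! i = xs ! j then of_nat (out_degree (with_proj G) (xs ! i)) else 0)
      - (if (xs ! i, xs ! j) \<in> parcs G then 1 else 0))"
  using assms unfolding laplacian_mat_def degree_mat_def adjacency_mat_def
  by (intro eq_matI) (auto simp: nth_eq_iff_index_eq)

lemma laplacian_spectrum_eq:
  assumes "distinct xs" "set xs = pverts G"
  shows "laplacian_spectrum G = proots (char_poly (laplacian_mat xs G))"
proof -
  define ys where "ys = (SOME xs. distinct xs \<and> set xs = pverts G)"
  have ys: "distinct ys" "set ys = pverts G"
    using someI[of "\<lambda>xs. distinct xs \<and> set xs = pverts G" xs] assms unfolding ys_def by auto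
  have "similar_mat (laplacian_mat ys G) (laplacian_mat xs G)"
    unfolding laplacian_mat_conv[OF ys(1)] laplacian_mat_conv[OF assms(1)]
    by (rule similar_mat_reindex) (use ys assms in auto)
  then show ?thesis
    unfolding laplacian_spectrum_def ys_def[symmetric] by (simp add: char_poly_similar)
qed

lemma pair_graph_cayley_graph:
  assumes "group G" "finite (carrier G)" "H \<subseteq> carrier G" "\<one>\<^bsub>G\<^esub> \<notin> H"
    and "\<And>h. h \<in> H \<Longrightarrow> inv\<^bsub>G\<^esub> h \<in> H"
  shows "pair_graph (cayley_graph G H)"
proof -
  interpret group G by fact
  have "finite (parcs (cayley_graph G H))"
    by (rule finite_subset[of _ "carrier G \<times> carrier G"]) (auto simp: cayley_graph_def assms(2))
  moreover have "inv\<^bsub>G\<^esub> y \<otimes>\<^bsub>G\<^esub> x \<in> H"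
    if "x \<in> carrier G" "y \<in> carrier G" "inv\<^bsub>G\<^esub> x \<otimes>\<^bsub>G\<^esub> y \<in> H" for x y
    using assms(5)[OF that(3)] that(1,2) by (simp add: inv_mult_group)
  ultimately show ?thesis
    using assms(2,4)
    by unfold_locales (auto simp: cayley_graph_def symmetric_def sym_def)
qed

lemma pair_graph_graph_join:
  assumes "pair_graph G" "pair_graph H"
  shows "pair_graph (G \<nabla> H)"
proof -
  interpret G: pair_graph G by fact
  interpret H: pair_graph H by fact
  have sub: "parcs (G \<nabla> H) \<subseteq> pverts (G \<nabla> H) \<times> pverts (G \<nabla> H)"
    by (auto simp: graph_join_def dest: G.wellformed' H.wellformed')
  have fin: "finite (pverts (G \<nabla> H))"
    by (simp add: graph_join_def G.pair_finite_verts H.pair_finite_verts)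
  have "finite (parcs (G \<nabla> H))"
    using finite_subset[OF sub] fin by simp
  moreover have "sym (parcs (G \<nabla> H))"
    unfolding sym_def graph_join_def by (auto intro: G.arcs_symmetric H.arcs_symmetric)
  moreover have "fst e \<noteq> snd e" if "e \<in> parcs (G \<nabla> H)" for e
    using that by (auto simp: graph_join_def dest: G.no_loops' H.no_loops')
  ultimately show ?thesis
    using sub fin by unfold_locales (auto simp: symmetric_def)
qed

end

theory Submission
  imports Defs "Jordan_Normal_Form.Schur_Decomposition"
begin

text \<open>
  The graph is complete multipartite: its non-adjacency relation is an equivalence whose classes have
  size \<open>1\<close> or \<open>q = p\<^bsup>m-1\<^esup>\<close>. For a graph on \<open>N\<close> vertices with Laplacian \<open>L\<close>, let
  \<open>M = N I - J - L\<close> be the Laplacian of its complement. Non-adjacency is an equivalence with class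
  sizes in \<open>{1, q}\<close> iff \<open>B = M\<^sup>2 - q M\<close> vanishes, and since \<open>B\<close> is real symmetric this means
  \<open>tr B\<^sup>2 = 0\<close>. As \<open>L J = J L = 0\<close>, the number \<open>tr B\<^sup>2\<close> is \<open>tr (f L)\<^sup>2\<close> minus a
  constant, where \<open>f\<close> is a polynomial depending only on \<open>N\<close> and \<open>q\<close>; hence it is determined by the
  Laplacian spectrum, and a cospectral graph is complete multipartite with the same possible class
  sizes. Finally \<open>tr L\<close> fixes how many classes of each size there are.
\<close>

section \<open>Traces and characteristic polynomials\<close>

definition mat_trace :: "'a :: comm_monoid_add mat \<Rightarrow> 'a" where
  "mat_trace A = sum_list (diag_mat A)"

lemma mat_trace_carrier:
  "A \<in> carrier_mat n n \<Longrightarrow> mat_trace A = (\<Sum>i<n. A $$ (i, i))"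
  by (auto simp: mat_trace_def diag_mat_def interv_sum_list_conv_sum_set_nat atLeast0LessThan)

lemma mat_trace_mult:
  assumes "A \<in> carrier_mat n m" "B \<in> carrier_mat m n"
  shows "mat_trace (A * B) = (\<Sum>i<n. \<Sum>j<m. A $$ (i, j) * B $$ (j, i))"
  using assms by (subst mat_trace_carrier[of _ n]) (auto simp: scalar_prod_def atLeast0LessThan)

lemma mat_trace_mult_commute:
  fixes A :: "'a :: comm_semiring_0 mat"
  assumes "A \<in> carrier_mat n m" "B \<in> carrier_mat m n"
  shows "mat_trace (A * B) = mat_trace (B * A)"
  unfolding mat_trace_mult[OF assms] mat_trace_mult[OF assms(2,1)]
  by (subst sum.swap) (simp add: mult.commute)

lemma mat_trace_similar:
  fixes A :: "'a :: comm_ring_1 mat"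
  assumes "similar_mat A B"
  shows "mat_trace A = mat_trace B"
proof -
  obtain n P Q where carr: "{A, B, P, Q} \<subseteq> carrier_mat n n"
    and QP: "Q * P = 1\<^sub>m n" and A: "A = P * B * Q"
    using similar_matD[OF assms] by blast
  have "mat_trace A = mat_trace (Q * (P * B))"
    unfolding A using carr by (intro mat_trace_mult_commute[of _ n n]) auto
  also have "Q * (P * B) = Q * P * B"
    using carr by (intro assoc_mult_mat[symmetric, of _ n n _ n _ n]) auto
  also have "\<dots> = B"
    using carr QP by auto
  finally show ?thesis .
qed

section \<open>Quadratic polynomials in a matrix and their spectra\<close>

text \<open>Evaluates the monic quadratic \<open>X^2 - s X + t\<close> at a matrix. Two uses cover
  everything needed: the polynomial f of the overview, and plain squaring as
  \<open>quad_mat 0 0\<close>. Thus f(L)^2 is a composition of two quadratics, and one spectral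
  lemma is applied twice.\<close>

definition quad_mat :: "'a :: comm_ring_1 \<Rightarrow> 'a \<Rightarrow> 'a mat \<Rightarrow> 'a mat" where
  "quad_mat s t A = A * A - s \<cdot>\<^sub>m A + t \<cdot>\<^sub>m 1\<^sub>m (dim_row A)"

lemma quad_mat_carrier [simp]: "A \<in> carrier_mat n n \<Longrightarrow> quad_mat s t A \<in> carrier_mat n n"
  by (auto simp: quad_mat_def)

lemma quad_mat_dim [simp]: "dim_row (quad_mat s t A) = dim_row A"
  by (simp add: quad_mat_def)

lemma quad_mat_index:
  assumes "A \<in> carrier_mat n n" "i < n" "j < n"
  shows "quad_mat s t A $$ (i, j)
    = (\<Sum>k<n. A $$ (i, k) * A $$ (k, j)) - s * A $$ (i, j) + (if i = j then t else 0)"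
  using assms by (auto simp: quad_mat_def scalar_prod_def atLeast0LessThan)

text \<open>Conjugation by an invertible matrix is an algebra homomorphism, so it commutes with
  evaluating a polynomial.\<close>

lemma similar_mat_quad_mat:
  assumes "similar_mat A B"
  shows "similar_mat (quad_mat s t A) (quad_mat s t B)"
proof -
  obtain n P Q where carr: "{A, B, P, Q} \<subseteq> carrier_mat n n"
    and PQ: "P * Q = 1\<^sub>m n" and QP: "Q * P = 1\<^sub>m n" and A: "A = P * B * Q"
    using similar_matD[OF assms] by blast
  then have A': "A \<in> carrier_mat n n" and B: "B \<in> carrier_mat n n"
    and P: "P \<in> carrier_mat n n" and Q: "Q \<in> carrier_mat n n" by auto
  have 1: "P * (B * B) * Q = A * A"
  proof -
    have "A * A = P * B * (Q * P) * (B * Q)"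
      unfolding A using P Q B by (simp add: assoc_mult_mat[of _ n n _ n _ n])
    then show ?thesis using P Q B by (simp add: QP assoc_mult_mat[of _ n n _ n _ n])
  qed
  have 2: "P * (s \<cdot>\<^sub>m B) * Q = s \<cdot>\<^sub>m A"
    unfolding A using P Q B
    by (simp add: mult_smult_distrib[of _ n n _ n] mult_smult_assoc_mat[of _ n n _ n])
  have 3: "P * (t \<cdot>\<^sub>m 1\<^sub>m n) * Q = t \<cdot>\<^sub>m 1\<^sub>m n"
    using P Q
    by (simp add: mult_smult_distrib[of _ n n _ n] mult_smult_assoc_mat[of _ n n _ n] PQ)
  have "P * quad_mat s t B * Q
      = P * (B * B) * Q - P * (s \<cdot>\<^sub>m B) * Q + P * (t \<cdot>\<^sub>m 1\<^sub>m n) * Q"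
  proof -
    have BB: "B * B \<in> carrier_mat n n" and sB: "s \<cdot>\<^sub>m B \<in> carrier_mat n n"
      and t1: "t \<cdot>\<^sub>m 1\<^sub>m n \<in> carrier_mat n n" and "dim_row B = n"
      using B by auto
    have "P * quad_mat s t B = P * (B * B) - P * (s \<cdot>\<^sub>m B) + P * (t \<cdot>\<^sub>m 1\<^sub>m n)"
      unfolding quad_mat_def \<open>dim_row B = n\<close>
      by (simp only: mult_add_distrib_mat[OF P minus_carrier_mat[OF sB] t1]
          mult_minus_distrib_mat[OF P BB sB])
    also have "\<dots> * Q = P * (B * B) * Q - P * (s \<cdot>\<^sub>m B) * Q + P * (t \<cdot>\<^sub>m 1\<^sub>m n) * Q"
      by (simp only: add_mult_distrib_mat[OF minus_carrier_mat[OF mult_carrier_mat[OF P sB]]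
            mult_carrier_mat[OF P t1] Q]
          minus_mult_distrib_mat[OF mult_carrier_mat[OF P BB] mult_carrier_mat[OF P sB] Q])
    finally show ?thesis .
  qed
  then have "quad_mat s t A = P * quad_mat s t B * Q"
    unfolding 1 2 3 using A' by (simp add: quad_mat_def)
  then show ?thesis
    using P Q B A' PQ QP by (intro similar_matI[of _ _ P Q n]) auto
qed

text \<open>In a product of two upper triangular matrices the entries below the diagonal are sums of
  zero terms, and a diagonal entry keeps only the term with all indices equal. Hence the diagonal
  transforms entrywise under the polynomial.\<close>

lemma upper_triangular_quad_mat:
  assumes U: "U \<in> carrier_mat n n" "upper_triangular U"
  shows "upper_triangular (quad_mat s t U)"
    and "diag_mat (quad_mat s t U) = map (\<lambda>u. u * u - s * u + t) (diag_mat U)"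
proof -
  have z: "U $$ (i, j) = 0" if "j < i" "i < n" for i j
    using U that by auto
  have "(\<Sum>k<n. U $$ (i, k) * U $$ (k, j)) = 0" if "j < i" "i < n" for i j
  proof (rule sum.neutral, rule ballI)
    fix k assume "k \<in> {..<n}"
    then show "U $$ (i, k) * U $$ (k, j) = 0"
      using z[of k i] z[of j k] that by (cases "k < i") auto
  qed
  then show "upper_triangular (quad_mat s t U)"
    using U(1) z by (intro upper_triangularI) (simp add: quad_mat_index[OF U(1)])
  have "(\<Sum>k<n. U $$ (i, k) * U $$ (k, i)) = U $$ (i, i) * U $$ (i, i)" if "i < n" for i
  proof -
    have "(\<Sum>k<n. U $$ (i, k) * U $$ (k, i))
        = (\<Sum>k<n. if k = i then U $$ (i, i) * U $$ (i, i) else 0)"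
    proof (rule sum.cong)
      fix k assume "k \<in> {..<n}"
      then show "U $$ (i, k) * U $$ (k, i) = (if k = i then U $$ (i, i) * U $$ (i, i) else 0)"
        using z[of k i] z[of i k] that by (cases k i rule: linorder_cases) auto
    qed simp
    then show ?thesis using that by simp
  qed
  then show "diag_mat (quad_mat s t U) = map (\<lambda>u. u * u - s * u + t) (diag_mat U)"
    using U(1) by (simp add: diag_mat_def quad_mat_index[OF U(1)])
qed

text \<open>Schur decomposition lets the order of the eigenvalues on the diagonal be prescribed. Two
  matrices with equal characteristic polynomials can therefore be given the same diagonal.\<close>

lemma complex_triangularize:
  fixes A :: "complex mat"
  assumes "A \<in> carrier_mat n n" "char_poly A = (\<Prod>a\<leftarrow>as. [:- a, 1:])"
  obtains U where "U \<in> carrier_mat n n" "upper_triangular U" "similar_mat A U" "diag_mat U = as"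
proof -
  obtain U P Q where s: "schur_decomposition A as = (U, P, Q)"
    by (cases "schur_decomposition A as") auto
  note * = schur_decomposition[OF assms s]
  show ?thesis
    using that[of U] * similar_mat_witD2[OF assms(1), of U P Q] unfolding similar_mat_def by blast
qed

lemma char_poly_eq_imp_mat_trace_eq:
  fixes A B :: "complex mat"
  assumes "A \<in> carrier_mat n n" "B \<in> carrier_mat n n" "char_poly A = char_poly B"
  shows "mat_trace A = mat_trace B"
proof -
  obtain as where as: "char_poly A = (\<Prod>a\<leftarrow>as. [:- a, 1:])"
    using char_poly_factorized[OF assms(1)] by blast
  obtain U where U: "similar_mat A U" "diag_mat U = as"
    using complex_triangularize[OF assms(1) as] by blast
  obtain W where W: "similar_mat B W" "diag_mat W = as"
    using complex_triangularize[OF assms(2)] as assms(3) by metis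
  show ?thesis
    using mat_trace_similar[OF U(1)] mat_trace_similar[OF W(1)] U(2) W(2)
    by (simp add: mat_trace_def)
qed

text \<open>Spectral mapping with multiplicities: each eigenvalue \<open>a\<close> becomes
  \<open>a * a - s * a + t\<close>, so the new characteristic polynomial depends on the old one
  only.\<close>

lemma char_poly_quad_mat_cong:
  fixes A B :: "complex mat"
  assumes "A \<in> carrier_mat n n" "B \<in> carrier_mat n n" "char_poly A = char_poly B"
  shows "char_poly (quad_mat s t A) = char_poly (quad_mat s t B)"
proof -
  obtain as where as: "char_poly A = (\<Prod>a\<leftarrow>as. [:- a, 1:])"
    using char_poly_factorized[OF assms(1)] by blast
  have "char_poly (quad_mat s t C) = (\<Prod>a\<leftarrow>as. [:- (a * a - s * a + t), 1:])"
    if C: "C \<in> carrier_mat n n" "char_poly C = (\<Prod>a\<leftarrow>as. [:- a, 1:])" for C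
  proof -
    obtain U where U: "U \<in> carrier_mat n n" "upper_triangular U" "similar_mat C U" "diag_mat U = as"
      using complex_triangularize[OF C] .
    show ?thesis
      unfolding char_poly_similar[OF similar_mat_quad_mat[OF U(3)]]
        char_poly_upper_triangular[OF quad_mat_carrier[OF U(1)] upper_triangular_quad_mat(1)[OF U(1,2)]]
        upper_triangular_quad_mat(2)[OF U(1,2)] U(4)
      by (simp add: o_def)
  qed
  from this[OF assms(1) as] this[OF assms(2)] show ?thesis using assms(3) as by simp
qed

text \<open>Over the complex numbers a characteristic polynomial splits into monic linear factors,
  so its roots determine it, and their number is the size of the matrix.\<close>

lemma char_poly_eq_if_proots_eq:
  fixes A B :: "complex mat"
  assumes A: "A \<in> carrier_mat n n" and B: "B \<in> carrier_mat k k"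
    and eq: "proots (char_poly A) = proots (char_poly B)"
  shows "n = k" "char_poly A = char_poly B"
proof -
  obtain as bs where as: "char_poly A = (\<Prod>a\<leftarrow>as. [:- a, 1:])" "length as = n"
    and bs: "char_poly B = (\<Prod>a\<leftarrow>bs. [:- a, 1:])" "length bs = k"
    using char_poly_factorized[OF A] char_poly_factorized[OF B] by blast
  have pr: "proots (\<Prod>a\<leftarrow>cs. [:- a, 1:]) = mset cs" for cs :: "complex list"
  proof (induction cs)
    case (Cons c cs)
    have "(\<Prod>a\<leftarrow>cs. [:- a, 1:]) \<noteq> 0"
      by (auto simp: prod_list_zero_iff)
    then have "proots ([:- c, 1:] * (\<Prod>a\<leftarrow>cs. [:- a, 1:])) = {#c#} + mset cs"
      using Cons by (subst proots_mult) auto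
    then show ?case by (simp del: mult_pCons_left)
  qed simp
  have ms: "mset as = mset bs"
    using eq unfolding as bs pr .
  then show "n = k" using as bs by (metis size_mset)
  show "char_poly A = char_poly B"
    unfolding as bs using ms by (metis mset_map prod_mset_prod_list)
qed

section \<open>The Laplacian of the complement\<close>

definition nonadjacency :: "'a pair_pre_digraph \<Rightarrow> 'a rel" where
  "nonadjacency G = pverts G \<times> pverts G - parcs G"

text \<open>The Laplacian of the graph whose edges are the off-diagonal pairs of the reflexive relation \<open>R\<close>:
  the loop at \<open>x\<close> contributes to both terms and cancels.\<close>

definition colaplacian :: "'a rel \<Rightarrow> 'a \<Rightarrow> 'a \<Rightarrow> int" where
  "colaplacian R x y =
    (if x = y then int (card (R `` {x})) else 0) - (if (x, y) \<in> R then 1 else 0)"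

text \<open>An entry of the matrix B of the overview, indexed by vertices and integer valued, so
  that a vanishing sum of squares forces every entry to vanish.\<close>

definition colaplacian_defect :: "'a set \<Rightarrow> 'a rel \<Rightarrow> int \<Rightarrow> 'a \<Rightarrow> 'a \<Rightarrow> int" where
  "colaplacian_defect V R q x y =
    (\<Sum>z\<in>V. colaplacian R x z * colaplacian R z y) - q * colaplacian R x y"

context
  fixes V :: "'a set" and R :: "'a rel"
  assumes finite: "finite V" and sub: "R \<subseteq> V \<times> V" and sym: "sym R"
begin

lemma sum_indicator_Image: "(\<Sum>y\<in>V. if (x, y) \<in> R then 1 else 0) = int (card (R `` {x}))"
proof -
  have "R `` {x} = V \<inter> {y. (x, y) \<in> R}" using sub by auto
  then show ?thesis using finite by (simp add: sum.If_cases)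
qed

lemma sum_colaplacian: "x \<in> V \<Longrightarrow> (\<Sum>y\<in>V. colaplacian R x y) = 0"
  using finite by (simp add: colaplacian_def sum_subtractf sum_indicator_Image)

lemma colaplacian_commute: "colaplacian R x y = colaplacian R y x"
  using sym by (auto simp: colaplacian_def dest: symD)

lemma sum_colaplacian': "x \<in> V \<Longrightarrow> (\<Sum>y\<in>V. colaplacian R y x) = 0"
  using sum_colaplacian by (simp add: colaplacian_commute[of _ x])

text \<open>Expand (D - A)^2 = D^2 - DA - AD + A^2, where A is the 0-1 matrix of \<open>R\<close>
  and D holds its row sums. By symmetry of \<open>R\<close>, an entry of A^2 counts the common
  neighbours.\<close>

lemma colaplacian_square:
  assumes "x \<in> V" "y \<in> V"
  shows "(\<Sum>z\<in>V. colaplacian R x z * colaplacian R z y) =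
    (if x = y then int (card (R `` {x})) ^ 2 else 0)
    - (if (x, y) \<in> R then int (card (R `` {x})) + int (card (R `` {y})) else 0)
    + int (card (R `` {x} \<inter> R `` {y}))"
proof -
  define d where "d x = int (card (R `` {x}))" for x
  define a where "a x y = (if (x, y) \<in> R then 1 else 0 :: int)" for x y
  have "(\<Sum>z\<in>V. colaplacian R x z * colaplacian R z y) =
      (\<Sum>z\<in>V. (if z = x then (if x = y then d x ^ 2 else 0) else 0)
        - (if z = x then d x * a x y else 0) - (if z = y then a x y * d y else 0) + a x z * a z y)"
    by (rule sum.cong) (auto simp: colaplacian_def d_def a_def algebra_simps power2_eq_square)
  also have "\<dots> = (if x = y then d x ^ 2 else 0) - d x * a x y - a x y * d y + (\<Sum>z\<in>V. a x z * a z y)"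
    using finite assms by (simp add: sum.distrib sum_subtractf)
  also have "(\<Sum>z\<in>V. a x z * a z y) = (\<Sum>z\<in>V. if z \<in> R `` {x} \<inter> R `` {y} then 1 else 0)"
    using sym by (intro sum.cong) (auto simp: a_def dest: symD)
  also have "\<dots> = int (card (R `` {x} \<inter> R `` {y}))"
  proof -
    have "V \<inter> (R `` {x} \<inter> R `` {y}) = R `` {x} \<inter> R `` {y}" using sub by auto
    then show ?thesis using finite by (subst sum.If_cases) (auto simp: Int_def)
  qed
  finally show ?thesis by (simp add: d_def a_def)
qed

text \<open>Since M J = 0, also B J = 0. This removes the cross term when B + (N - q) J is squared
  and traced.\<close>

lemma sum_colaplacian_defect:
  assumes "x \<in> V"
  shows "(\<Sum>y\<in>V. colaplacian_defect V R q x y) = 0"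
proof -
  have "(\<Sum>y\<in>V. \<Sum>z\<in>V. colaplacian R x z * colaplacian R z y) = 0"
    by (subst sum.swap) (simp add: sum_colaplacian flip: sum_distrib_left)
  then show ?thesis
    using assms by (simp add: colaplacian_defect_def sum_subtractf sum_colaplacian flip: sum_distrib_left)
qed

lemma colaplacian_defect_commute: "colaplacian_defect V R q x y = colaplacian_defect V R q y x"
  unfolding colaplacian_defect_def
  by (simp add: colaplacian_commute[of x] colaplacian_commute[of _ y] mult.commute)

text \<open>At an unrelated pair of distinct vertices the defect is the number of common neighbours,
  so its vanishing is transitivity. At a diagonal position it is \<open>(d - 1) * (d - q)\<close>
  with \<open>d\<close> the number of neighbours, which leaves two class sizes.\<close>

lemma equiv_if_colaplacian_defect_zero:
  assumes refl: "refl_on V R" and zero: "\<And>x y. x \<in> V \<Longrightarrow> y \<in> V \<Longrightarrow> colaplacian_defect V R (int q) x y = 0"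
  shows "equiv V R" and "\<And>x. x \<in> V \<Longrightarrow> card (R `` {x}) = 1 \<or> card (R `` {x}) = q"
proof -
  have fin: "Finite_Set.finite (R `` {x})" for x
    by (rule finite_subset[OF _ finite]) (use sub in auto)
  have "(x, y) \<in> R" if "(x, z) \<in> R" "(z, y) \<in> R" for x y z
  proof (rule ccontr)
    assume n: "(x, y) \<notin> R"
    have xy: "x \<in> V" "y \<in> V" using that sub by auto
    have "x \<noteq> y" using n refl xy by (auto dest: refl_onD)
    then have "card (R `` {x} \<inter> R `` {y}) = 0"
      using zero[OF xy] n colaplacian_square[OF xy] by (simp add: colaplacian_defect_def colaplacian_def)
    moreover have "z \<in> R `` {x} \<inter> R `` {y}" using that sym by (auto dest: symD)
    ultimately show False using fin[of x] by auto
  qed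
  then show "equiv V R"
    using refl sub sym by (intro equivI) (auto intro: transI)
  fix x assume x: "x \<in> V"
  define d where "d = int (card (R `` {x}))"
  have "(x, x) \<in> R" using refl x by (auto dest: refl_onD)
  then have "d ^ 2 - 2 * d + d - int q * (d - 1) = 0"
    using zero[OF x x] colaplacian_square[OF x x]
    by (simp add: colaplacian_defect_def colaplacian_def d_def)
  then have "(d - 1) * (d - int q) = 0"
    by (simp add: algebra_simps power2_eq_square)
  then show "card (R `` {x}) = 1 \<or> card (R `` {x}) = q" by (auto simp: d_def)
qed

lemma colaplacian_defect_zero_if_equiv:
  assumes equiv: "equiv V R" and sizes: "\<And>x. x \<in> V \<Longrightarrow> card (R `` {x}) = 1 \<or> card (R `` {x}) = q"
    and xy: "x \<in> V" "y \<in> V"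
  shows "colaplacian_defect V R (int q) x y = 0"
proof (cases "(x, y) \<in> R")
  case False
  then have "R `` {x} \<inter> R `` {y} = {}" "x \<noteq> y"
    using equiv_class_nondisjoint[OF equiv, of _ x y] equiv_class_self[OF equiv xy(1)] by auto
  then show ?thesis
    using False colaplacian_square[OF xy] by (simp add: colaplacian_defect_def colaplacian_def)
next
  case True
  then have eq: "R `` {x} = R `` {y}" using equiv by (simp add: equiv_class_eq)
  show ?thesis
  proof (cases "x = y")
    case True
    then show ?thesis
      using \<open>(x, y) \<in> R\<close> colaplacian_square[OF xy] sizes[OF xy(1)]
      by (auto simp: colaplacian_defect_def colaplacian_def algebra_simps power2_eq_square)
  next
    case False
    \<comment> \<open>At a related pair of distinct vertices the defect is \<open>q\<close> minus
      the class size. Such a class has at least two elements, so the alternative of size 1 can only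
      persist if \<open>q\<close> is 1 as well.\<close>
    have "{x, y} \<subseteq> R `` {x}" using True equiv_class_self[OF equiv xy(1)] by auto
    then have "card {x, y} \<le> card (R `` {x})"
      by (intro card_mono finite_subset[OF _ finite]) (use sub in auto)
    then have "card (R `` {x}) = q" using False sizes[OF xy(1)] by auto
    then show ?thesis
      using False True eq colaplacian_square[OF xy] by (simp add: colaplacian_defect_def colaplacian_def)
  qed
qed

end

section \<open>Equivalence relations with matching class sizes\<close>

lemma quotient_class_eq:
  assumes "equiv A r" "C \<in> A // r" "x \<in> C"
  shows "r `` {x} = C"
proof -
  obtain y where "C = r `` {y}" using assms(2) by (rule quotientE)
  then show ?thesis using equiv_class_eq[OF assms(1), of y x] assms(3) by simp
qed

text \<open>The elements whose class has size \<open>k\<close> are partitioned by the classes of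
  size \<open>k\<close>. This turns counts of elements into counts of classes.\<close>

lemma card_classes_of_size:
  assumes "finite V" "equiv V R"
  shows "k * card {C \<in> V // R. card C = k} = card {x \<in> V. card (R `` {x}) = k}"
proof -
  have eq: "{x \<in> V. card (R `` {x}) = k} = \<Union>{C \<in> V // R. card C = k}"
  proof (rule Set.set_eqI, rule iffI)
    fix x assume "x \<in> {x \<in> V. card (R `` {x}) = k}"
    then show "x \<in> \<Union>{C \<in> V // R. card C = k}"
      using equiv_class_self[OF assms(2), of x] by (auto intro!: bexI[of _ "R `` {x}"] quotientI)
  next
    fix x assume "x \<in> \<Union>{C \<in> V // R. card C = k}"
    then obtain C where C: "C \<in> V // R" "card C = k" "x \<in> C" by auto
    then have "C = R `` {x}" "x \<in> V"
      using assms(2) by (auto elim!: quotientE simp: equiv_class_eq_iff[OF assms(2)]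
        dest: equiv_class_eq[OF assms(2)])
    then show "x \<in> {x \<in> V. card (R `` {x}) = k}" using C by auto
  qed
  show ?thesis
    unfolding eq
  proof (rule card_partition)
    show "finite {C \<in> V // R. card C = k}"
      using finite_quotient[OF assms(1), of R] equiv_type[OF assms(2)] by auto
    show "finite (\<Union>{C \<in> V // R. card C = k})"
      unfolding eq[symmetric] using assms by auto
  qed (use quotient_disj[OF assms(2)] in auto)
qed

text \<open>Equal counts of elements give equally many classes of each size. Classes are first
  matched size by size, then elements are matched within paired classes.\<close>

lemma equiv_iso_if_class_sizes_eq:
  assumes V: "finite V" "equiv V R" and W: "finite W" "equiv W S"
    and sizes: "\<And>k. card {x \<in> V. card (R `` {x}) = k} = card {x \<in> W. card (S `` {x}) = k}"
  obtains h where "bij_betw h V W" "\<And>x y. x \<in> V \<Longrightarrow> y \<in> V \<Longrightarrow> (h x, h y) \<in> S \<longleftrightarrow> (x, y) \<in> R"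
proof -
  note finV = finite_quotient[OF V(1) equiv_type[OF V(2)]]
    and finW = finite_quotient[OF W(1) equiv_type[OF W(2)]]
    and fC = finite_equiv_class[OF V(1) equiv_type[OF V(2)]]
    and fC' = finite_equiv_class[OF W(1) equiv_type[OF W(2)]]
  have "card {C \<in> V // R. card C = k} = card {C \<in> W // S. card C = k}" for k
  \<comment> \<open>The factor \<open>k\<close> cancels only when it is positive. Size 0 does not
    occur, because classes are finite and nonempty.\<close>
  proof (cases "k = 0")
    case True
    have empty: "{C \<in> V // R. card C = 0} = {}" "{C \<in> W // S. card C = 0} = {}"
      using fC fC' in_quotient_imp_non_empty[OF V(2)] in_quotient_imp_non_empty[OF W(2)]
      by (auto simp: card_gt_0_iff)
    show ?thesis unfolding True empty by simp
  next
    case False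
    have "k * card {C \<in> V // R. card C = k} = k * card {C \<in> W // S. card C = k}"
      unfolding card_classes_of_size[OF V] card_classes_of_size[OF W] by (rule sizes)
    with False show ?thesis unfolding mult_cancel1 by blast
  qed
  then have "\<exists>f. bij_betw f {C \<in> V // R. card C = k} {C \<in> W // S. card C = k}" for k
    using finV finW by (intro finite_same_card_bij) auto
  then have "\<forall>k. \<exists>f. bij_betw f {C \<in> V // R. card C = k} {C \<in> W // S. card C = k}" ..
  from choice[OF this] obtain f
    where f: "\<And>k. bij_betw (f k) {C \<in> V // R. card C = k} {C \<in> W // S. card C = k}"
    by blast
  \<comment> \<open>The bijections for the separate sizes are glued into one size-preserving
    bijection between the quotients.\<close>
  define F where "F C = f (card C) C" for C
  have F: "F C \<in> W // S" "card (F C) = card C" if "C \<in> V // R" for C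
    using bij_betwE[OF f[of "card C"]] that by (auto simp: F_def)
  have F_inj: "C = D" if "C \<in> V // R" "D \<in> V // R" "F C = F D" for C D
  proof -
    have "card C = card D" using F(2)[OF that(1)] F(2)[OF that(2)] that(3) by simp
    then show ?thesis
      using bij_betw_imp_inj_on[OF f[of "card D"]] that by (auto simp: F_def dest: inj_onD)
  qed
  have F_surj: "\<exists>C\<in>V // R. F C = D" if "D \<in> W // S" for D
  proof -
    have "D \<in> f (card D) ` {C \<in> V // R. card C = card D}"
      using bij_betw_imp_surj_on[OF f[of "card D"]] that by simp
    then obtain C where C: "C \<in> V // R" "card C = card D" "D = f (card D) C" by blast
    then have "F C = D" by (simp add: F_def)
    with C(1) show ?thesis by blast
  qed
  have "\<exists>g. bij_betw g C (F C)" if "C \<in> V // R" for C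
    using F[OF that] fC[OF that] fC' by (intro finite_same_card_bij) auto
  then have "\<forall>C\<in>V // R. \<exists>g. bij_betw g C (F C)" by blast
  from bchoice[OF this] obtain g where g: "\<And>C. C \<in> V // R \<Longrightarrow> bij_betw (g C) C (F C)"
    by blast
  \<comment> \<open>Each element is moved by the bijection chosen for its own class, so
    \<open>h\<close> maps classes onto classes.\<close>
  define h where "h x = g (R `` {x}) x" for x
  have cl: "R `` {x} \<in> V // R" "x \<in> R `` {x}" if "x \<in> V" for x
    using that by (rule quotientI, rule equiv_class_self[OF V(2)])
  have h: "h x \<in> F (R `` {x})" if "x \<in> V" for x
    using bij_betwE[OF g[OF cl(1)[OF that]]] cl[OF that] by (auto simp: h_def)
  have hW: "h x \<in> W" if "x \<in> V" for x
    using h[OF that] F(1)[OF cl(1)[OF that]] Union_quotient[OF W(2)] by blast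
  have hcl: "S `` {h x} = F (R `` {x})" if "x \<in> V" for x
    using quotient_class_eq[OF W(2) F(1)[OF cl(1)[OF that]] h[OF that]] .
  have iff: "(h x, h y) \<in> S \<longleftrightarrow> (x, y) \<in> R" if "x \<in> V" "y \<in> V" for x y
  proof -
    have "(h x, h y) \<in> S \<longleftrightarrow> F (R `` {x}) = F (R `` {y})"
      using eq_equiv_class_iff[OF W(2) hW hW, OF that] that by (simp add: hcl)
    also have "\<dots> \<longleftrightarrow> R `` {x} = R `` {y}" using F_inj[of "R `` {x}" "R `` {y}"] cl that by auto
    also have "\<dots> \<longleftrightarrow> (x, y) \<in> R" by (rule eq_equiv_class_iff[OF V(2) that])
    finally show ?thesis .
  qed
  have "inj_on h V"
  proof (rule inj_onI)
    fix x y assume xy: "x \<in> V" "y \<in> V" "h x = h y"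
    have "h x \<in> S `` {h x}" by (rule equiv_class_self[OF W(2) hW[OF xy(1)]])
    then have "(x, y) \<in> R" using iff[of x y] xy by simp
    then have eq: "R `` {x} = R `` {y}" by (rule equiv_class_eq[OF V(2)])
    then have "g (R `` {x}) x = g (R `` {x}) y" using xy(3) by (simp add: h_def)
    moreover have "x \<in> R `` {x}" "y \<in> R `` {x}" using cl(2) xy eq by auto
    ultimately show "x = y"
      using bij_betw_imp_inj_on[OF g[OF cl(1)[OF xy(1)]]] by (auto dest: inj_onD)
  qed
  moreover have "h ` V = W"
  proof
    show "W \<subseteq> h ` V"
    proof
      fix w assume w: "w \<in> W"
      obtain C where C: "C \<in> V // R" "F C = S `` {w}" using F_surj[OF quotientI[OF w]] by blast
      have "w \<in> g C ` C"
        unfolding bij_betw_imp_surj_on[OF g[OF C(1)]] C(2) by (rule equiv_class_self[OF W(2) w])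
      then obtain x where x: "x \<in> C" "g C x = w" by blast
      then have "x \<in> V" using C Union_quotient[OF V(2)] by blast
      moreover have "R `` {x} = C"
        using quotient_class_eq[OF V(2) C(1) x(1)] .
      ultimately show "w \<in> h ` V" using x by (auto simp: h_def)
    qed
  qed (use hW in auto)
  ultimately have "bij_betw h V W" by (simp add: bij_betw_def)
  then show ?thesis using that iff by blast
qed

section \<open>Laplacian matrices\<close>

lemma nonadjacency_props:
  assumes "pair_graph G"
  shows "finite (pverts G)" "nonadjacency G \<subseteq> pverts G \<times> pverts G" "sym (nonadjacency G)"
    "refl_on (pverts G) (nonadjacency G)"
proof -
  interpret pair_graph G by fact
  show "finite (pverts G)" by (rule pair_finite_verts)
  show "nonadjacency G \<subseteq> pverts G \<times> pverts G" "sym (nonadjacency G)"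
    "refl_on (pverts G) (nonadjacency G)"
    by (auto simp: nonadjacency_def sym_def refl_on_def intro: arcs_symmetric dest: no_loops')
qed

text \<open>A vertex is nonadjacent to itself, so its own class absorbs the usual "minus one".
  Working in the integers avoids truncated subtraction.\<close>

lemma out_degree_eq:
  assumes "pair_graph G" "x \<in> pverts G"
  shows "int (out_degree (with_proj G) x) = int (card (pverts G)) - int (card (nonadjacency G `` {x}))"
proof -
  interpret pair_graph G by fact
  note props = nonadjacency_props[OF assms(1)]
  have sub: "nonadjacency G `` {x} \<subseteq> pverts G" using props(2) by auto
  have "out_arcs (with_proj G) x = Pair x ` (pverts G - nonadjacency G `` {x})"
    using assms(2) by (auto simp: out_arcs_def nonadjacency_def dest: in_arcsD2)
  then have "out_degree (with_proj G) x = card (pverts G - nonadjacency G `` {x})"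
    by (simp add: out_degree_def card_image inj_on_def)
  also have "\<dots> = card (pverts G) - card (nonadjacency G `` {x})"
    using sub props(1) by (intro card_Diff_subset) (auto intro: finite_subset)
  finally show ?thesis using card_mono[OF props(1) sub] by simp
qed

lemma laplacian_mat_carrier: "laplacian_mat xs G \<in> carrier_mat (length xs) (length xs)"
  by (auto simp: laplacian_mat_def degree_mat_def adjacency_mat_def)

context
  fixes G :: "'a pair_pre_digraph" and xs :: "'a list"
  assumes G: "pair_graph G" and xs: "distinct xs" "set xs = pverts G"
begin

text \<open>The Laplacians of a graph and of its complement add up to N I - J.\<close>

lemma laplacian_mat_index:
  assumes "i < length xs" "j < length xs"
  shows "laplacian_mat xs G $$ (i, j) = of_int
    ((if xs ! i = xs ! j then int (card (pverts G)) else 0) - 1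
      - colaplacian (nonadjacency G) (xs ! i) (xs ! j))"
proof -
  have mem: "xs ! i \<in> pverts G" "xs ! j \<in> pverts G"
    using assms xs nth_mem by blast+
  have deg: "of_nat (out_degree (with_proj G) (xs ! i))
      = (of_int (int (card (pverts G)) - int (card (nonadjacency G `` {xs ! i}))) :: complex)"
    using out_degree_eq[OF G mem(1)] by (metis of_int_of_nat_eq)
  have "(xs ! i, xs ! j) \<in> nonadjacency G \<longleftrightarrow> (xs ! i, xs ! j) \<notin> parcs G"
    using mem by (auto simp: nonadjacency_def)
  then show ?thesis
    using assms deg
    by (cases "xs ! i = xs ! j") (simp_all add: laplacian_mat_conv[OF xs(1)] colaplacian_def)
qed

lemma sum_nth_pverts: "(\<Sum>i<length xs. f (xs ! i)) = (\<Sum>x\<in>pverts G. f x)"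
  using sum.reindex_bij_betw[OF bij_betw_nth[OF xs(1) refl refl], of f] xs(2) by simp

lemma mat_trace_laplacian_mat:
  "mat_trace (laplacian_mat xs G)
    = of_int (\<Sum>x\<in>pverts G. int (card (pverts G)) - int (card (nonadjacency G `` {x})))"
proof -
  have "mat_trace (laplacian_mat xs G) = (\<Sum>i<length xs.
      (\<lambda>x. of_int (int (card (pverts G)) - 1 - colaplacian (nonadjacency G) x x)) (xs ! i))"
    by (simp add: mat_trace_carrier[OF laplacian_mat_carrier] laplacian_mat_index)
  also have "\<dots> = (\<Sum>x\<in>pverts G. of_int (int (card (pverts G)) - 1 - colaplacian (nonadjacency G) x x))"
    by (rule sum_nth_pverts)
  also have "\<dots> = (\<Sum>x\<in>pverts G. of_int (int (card (pverts G)) - int (card (nonadjacency G `` {x}))))"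
    using nonadjacency_props(4)[OF G] by (intro sum.cong) (auto simp: colaplacian_def dest: refl_onD)
  finally show ?thesis by simp
qed

text \<open>With \<open>L = N I - J - M\<close> and \<open>M J = J M = 0\<close>, the polynomial
  \<open>(N - X)\<^sup>2 - q (N - X)\<close> maps \<open>L\<close> to \<open>M\<^sup>2 - q M + (N - q) J\<close>.\<close>

lemma quad_mat_laplacian_mat_index:
  fixes q :: int
  defines "N \<equiv> int (card (pverts G))"
  assumes ij: "i < length xs" "j < length xs"
  shows "quad_mat (of_int (2 * N - q)) (of_int (N * (N - q))) (laplacian_mat xs G) $$ (i, j)
    = of_int (colaplacian_defect (pverts G) (nonadjacency G) q (xs ! i) (xs ! j) + (N - q))"
proof -
  define V where "V = pverts G"
  define m where "m = colaplacian (nonadjacency G)"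
  define l where "l x y = (if x = y then N else 0) - 1 - m x y" for x y
  define x where "x = xs ! i"
  define y where "y = xs ! j"
  have xy: "x \<in> V" "y \<in> V"
    using ij xs nth_mem unfolding x_def y_def V_def by blast+
  note props = nonadjacency_props[OF G]
  have fin: "finite V" and cV: "int (card V) = N" using props(1) by (simp_all add: V_def N_def)
  have row: "(\<Sum>z\<in>V. m x z) = 0" and col: "(\<Sum>z\<in>V. m z y) = 0"
    using sum_colaplacian[OF props(1-3)] sum_colaplacian'[OF props(1-3)] xy by (simp_all add: V_def m_def)
  have "(\<Sum>k<length xs. laplacian_mat xs G $$ (i, k) * laplacian_mat xs G $$ (k, j))
      = (\<Sum>k<length xs. (\<lambda>z. of_int (l x z * l z y)) (xs ! k))"
    using ij by (intro sum.cong) (auto simp: laplacian_mat_index l_def x_def y_def m_def N_def)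
  also have "\<dots> = of_int (\<Sum>z\<in>V. l x z * l z y)"
    by (subst sum_nth_pverts) (simp add: V_def)
  \<comment> \<open>The multiple of the identity inside \<open>l\<close> contributes only at
    \<open>z = x\<close> and \<open>z = y\<close>. What remains is
    \<open>(1 + m x z) * (1 + m z y)\<close>, whose linear terms vanish on summation by
    \<open>row\<close> and \<open>col\<close>.\<close>
  also have "(\<Sum>z\<in>V. l x z * l z y) = (\<Sum>z\<in>V. (if z = x then N * l x y else 0)
      - (if z = y then N * (1 + m x y) else 0) + 1 + m z y + m x z + m x z * m z y)"
    by (intro sum.cong) (auto simp: l_def algebra_simps)
  also have "\<dots> = N * l x y - N * (1 + m x y) + N + (\<Sum>z\<in>V. m x z * m z y)"
    using fin xy row col cV by (simp add: sum.distrib sum_subtractf)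
  finally have *: "(\<Sum>k<length xs. laplacian_mat xs G $$ (i, k) * laplacian_mat xs G $$ (k, j))
    = of_int (N * l x y - N * (1 + m x y) + N + (\<Sum>z\<in>V. m x z * m z y))" .
  have ijeq: "i = j \<longleftrightarrow> x = y"
    using xs(1) ij by (simp add: x_def y_def nth_eq_iff_index_eq)
  have "quad_mat (of_int (2 * N - q)) (of_int (N * (N - q))) (laplacian_mat xs G) $$ (i, j)
     = of_int (N * l x y - N * (1 + m x y) + N + (\<Sum>z\<in>V. m x z * m z y)
        - (2 * N - q) * l x y + (if x = y then N * (N - q) else 0))"
    unfolding quad_mat_index[OF laplacian_mat_carrier ij] * ijeq
    using ij by (simp add: laplacian_mat_index l_def x_def y_def m_def N_def)
  also have "N * l x y - N * (1 + m x y) + N + (\<Sum>z\<in>V. m x z * m z y)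
        - (2 * N - q) * l x y + (if x = y then N * (N - q) else 0)
      = (\<Sum>z\<in>V. m x z * m z y) - q * m x y + (N - q)"
    by (simp add: l_def algebra_simps)
  finally show ?thesis by (simp add: colaplacian_defect_def V_def m_def x_def y_def)
qed

text \<open>The matrix f(L) = B + (N - q) J is symmetric, so the trace of its square is the sum of
  its squared entries. The rows of B sum to zero, so only the squares of B and a constant from J
  survive.\<close>

lemma mat_trace_quad_mat_laplacian_mat:
  fixes q :: int
  defines "N \<equiv> int (card (pverts G))"
  shows "mat_trace (quad_mat 0 0
      (quad_mat (of_int (2 * N - q)) (of_int (N * (N - q))) (laplacian_mat xs G)))
    = of_int ((\<Sum>x\<in>pverts G. \<Sum>y\<in>pverts G. (colaplacian_defect (pverts G) (nonadjacency G) q x y)\<^sup>2)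
        + N\<^sup>2 * (N - q)\<^sup>2)"
proof -
  define F where "F = quad_mat (of_int (2 * N - q)) (of_int (N * (N - q))) (laplacian_mat xs G)"
  define b where "b = colaplacian_defect (pverts G) (nonadjacency G) q"
  note props = nonadjacency_props[OF G]
  have F: "F \<in> carrier_mat (length xs) (length xs)"
    unfolding F_def by (intro quad_mat_carrier laplacian_mat_carrier)
  have idx: "F $$ (i, j) = of_int (b (xs ! i) (xs ! j) + (N - q))"
    if "i < length xs" "j < length xs" for i j
    using quad_mat_laplacian_mat_index[OF that] by (simp add: F_def N_def b_def)
  have sym: "b x y = b y x" for x y
    unfolding b_def by (rule colaplacian_defect_commute[OF props(1-3)])
  have "mat_trace (quad_mat 0 0 F)
      = (\<Sum>i<length xs. \<Sum>j<length xs. of_int ((b (xs ! i) (xs ! j) + (N - q)) ^ 2))"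
    unfolding mat_trace_carrier[OF quad_mat_carrier[OF F]]
    using F sym by (intro sum.cong) (auto simp: quad_mat_index idx power2_eq_square intro!: sum.cong)
  also have "\<dots> = (\<Sum>x\<in>pverts G. \<Sum>y\<in>pverts G. of_int ((b x y + (N - q)) ^ 2))"
    by (simp only: sum_nth_pverts[of "\<lambda>y. of_int ((b _ y + (N - q)) ^ 2)"]
        sum_nth_pverts[of "\<lambda>x. \<Sum>y\<in>pverts G. of_int ((b x y + (N - q)) ^ 2)"])
  also have "\<dots> = of_int (\<Sum>x\<in>pverts G. \<Sum>y\<in>pverts G. (b x y + (N - q)) ^ 2)"
    by simp
  also have "(\<Sum>x\<in>pverts G. \<Sum>y\<in>pverts G. (b x y + (N - q)) ^ 2)
      = (\<Sum>x\<in>pverts G. (\<Sum>y\<in>pverts G. (b x y)\<^sup>2) + N * (N - q)\<^sup>2)"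
  proof (rule sum.cong)
    fix x assume x: "x \<in> pverts G"
    have "(\<Sum>y\<in>pverts G. (b x y + c) ^ 2)
        = (\<Sum>y\<in>pverts G. (b x y)\<^sup>2) + 2 * (\<Sum>y\<in>pverts G. b x y) * c + N * c\<^sup>2" for c
      by (simp add: power2_sum sum.distrib N_def flip: sum_distrib_left sum_distrib_right)
    then show "(\<Sum>y\<in>pverts G. (b x y + (N - q)) ^ 2) = (\<Sum>y\<in>pverts G. (b x y)\<^sup>2) + N * (N - q)\<^sup>2"
      using sum_colaplacian_defect[OF props(1-3) x, of q] by (simp add: b_def)
  qed simp
  finally show ?thesis
    by (simp add: F_def b_def sum.distrib N_def power2_eq_square mult_ac)
qed

end

section \<open>From the Laplacian spectrum to an isomorphism\<close>

lemma digraph_iso_with_projI: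
  assumes H: "pair_graph H" and G: "pair_graph G" and h: "bij_betw h (pverts H) (pverts G)"
    and iff: "\<And>x y. x \<in> pverts H \<Longrightarrow> y \<in> pverts H \<Longrightarrow> (h x, h y) \<in> parcs G \<longleftrightarrow> (x, y) \<in> parcs H"
  shows "digraph_iso (with_proj H) (with_proj G)"
proof -
  interpret H: pair_graph H by fact
  interpret G: pair_graph G by fact
  \<comment> \<open>Arcs are ordered pairs of vertices, so the vertex map dictates the arc map, and
    the projections serve as tail and head.\<close>
  define f where "f = \<lparr>iso_verts = h, iso_arcs = map_prod h h, iso_head = snd, iso_tail = fst\<rparr>"
  have inj: "inj_on h (pverts H)" and im: "h ` pverts H = pverts G"
    using h by (auto simp: bij_betw_def)
  have "inj_on (map_prod h h) (parcs H)"
    by (rule inj_on_subset[OF map_prod_inj_on[OF inj inj]]) (auto dest: H.wellformed')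
  moreover have "wf_digraph (with_proj H)" ..
  ultimately have "H.digraph_isomorphism f"
    using inj by (auto simp: H.digraph_isomorphism_def f_def)
  moreover have "parcs G = map_prod h h ` parcs H"
  proof (intro equalityI subsetI)
    fix e assume e: "e \<in> parcs G"
    obtain a b where ab: "e = (a, b)" by (cases e)
    then have "a \<in> h ` pverts H" "b \<in> h ` pverts H" using e im G.wellformed' by auto
    then obtain x y where "x \<in> pverts H" "y \<in> pverts H" "e = (h x, h y)" using ab by auto
    then show "e \<in> map_prod h h ` parcs H" using e iff by (auto intro!: rev_image_eqI[of "(x, y)"])
  next
    fix e assume "e \<in> map_prod h h ` parcs H"
    then show "e \<in> parcs G" using iff by (auto dest: H.wellformed')
  qed
  then have "with_proj G = app_iso f (with_proj H)"
    using im by (simp add: app_iso_def f_def with_proj_def)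
  ultimately show ?thesis unfolding digraph_iso_def by blast
qed

text \<open>With values in {1, q}, the sum is the cardinality plus \<open>q - 1\<close> times the
  number of points of value \<open>q\<close>. It is applied to class sizes, whose sum is read off
  from tr L.\<close>

lemma card_fibre_eq_if_sum_eq:
  fixes f :: "'a \<Rightarrow> nat" and g :: "'b \<Rightarrow> nat"
  assumes "finite A" "finite B" "card A = card B" "(\<Sum>x\<in>A. int (f x)) = (\<Sum>x\<in>B. int (g x))"
    and f: "\<And>x. x \<in> A \<Longrightarrow> f x = 1 \<or> f x = q" and g: "\<And>x. x \<in> B \<Longrightarrow> g x = 1 \<or> g x = q"
  shows "card {x \<in> A. f x = k} = card {x \<in> B. g x = k}"
\<comment> \<open>Here the factor \<open>q - 1\<close> vanishes and the sum carries no information,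
  but every value is then 1.\<close>
proof (cases "q = 1")
  case True
  then have "{x \<in> A. f x = k} = (if k = 1 then A else {})" "{x \<in> B. g x = k} = (if k = 1 then B else {})"
    using f g by force+
  then show ?thesis using assms(3) by simp
next
  case False
  have sum: "(\<Sum>x\<in>C. int (h x)) = int (card C) + (int q - 1) * int (card {x \<in> C. h x = q})"
    and compl: "card {x \<in> C. h x = 1} = card C - card {x \<in> C. h x = q}"
    if "finite C" and h: "\<And>x. x \<in> C \<Longrightarrow> h x = 1 \<or> h x = q" for C :: "'c set" and h
  proof -
    have "(\<Sum>x\<in>C. int (h x)) = (\<Sum>x\<in>C. 1 + (if h x = q then int q - 1 else 0))"
      using h by (intro sum.cong) force+
    also have "\<dots> = int (card C) + (int q - 1) * int (card {x \<in> C. h x = q})"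
      using \<open>finite C\<close> by (simp add: sum.distrib sum.If_cases Int_def mult.commute)
    finally show "(\<Sum>x\<in>C. int (h x)) = \<dots>" .
    have "{x \<in> C. h x = 1} = C - {x \<in> C. h x = q}" using h False by force
    then show "card {x \<in> C. h x = 1} = card C - card {x \<in> C. h x = q}"
      using \<open>finite C\<close> by (simp add: card_Diff_subset)
  qed
  have q: "card {x \<in> A. f x = q} = card {x \<in> B. g x = q}"
    using sum[OF assms(1) f] sum[OF assms(2) g] assms(3,4) False by simp
  consider "k = 1" | "k = q" | "k \<noteq> 1" "k \<noteq> q" by blast
  then show ?thesis
  proof cases
    case 1
    then show ?thesis using compl[OF assms(1) f] compl[OF assms(2) g] assms(3) q by simp
  next
    case 3
    then have empty: "{x \<in> A. f x = k} = {}" "{x \<in> B. g x = k} = {}" using f g by force+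
    show ?thesis unfolding empty by simp
  qed (use q in simp)
qed

lemma laplacian_spectrum_determines_multipartite:
  assumes G: "pair_graph G" and equiv: "equiv (pverts G) (nonadjacency G)"
    and sizes: "\<And>x. x \<in> pverts G \<Longrightarrow> card (nonadjacency G `` {x}) = 1 \<or> card (nonadjacency G `` {x}) = q"
    and H: "pair_graph H" and spec: "laplacian_spectrum H = laplacian_spectrum G"
  shows "digraph_iso (with_proj H) (with_proj G)"
proof -
  note Gp = nonadjacency_props[OF G] and Hp = nonadjacency_props[OF H]
  define V where "V = pverts G"
  define W where "W = pverts H"
  define R where "R = nonadjacency G"
  define S where "S = nonadjacency H"
  obtain xs where xs: "distinct xs" "set xs = pverts G"
    using finite_distinct_list[OF Gp(1)] by blast
  obtain ys where ys: "distinct ys" "set ys = pverts H"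
    using finite_distinct_list[OF Hp(1)] by blast
  note car = laplacian_mat_carrier[of ys H] laplacian_mat_carrier[of xs G]
  have pr: "proots (char_poly (laplacian_mat ys H)) = proots (char_poly (laplacian_mat xs G))"
    using spec laplacian_spectrum_eq[OF xs] laplacian_spectrum_eq[OF ys] by simp
  note len = char_poly_eq_if_proots_eq(1)[OF car pr] and cp = char_poly_eq_if_proots_eq(2)[OF car pr]
  have card: "card W = card V"
    using len xs ys distinct_card unfolding V_def W_def by metis
  \<comment> \<open>tr L is the sum of the degrees, that is N^2 minus the sum of the class sizes
    over all vertices.\<close>
  have tr: "(\<Sum>x\<in>W. int (card (S `` {x}))) = (\<Sum>x\<in>V. int (card (R `` {x})))"
  proof -
    have "mat_trace (laplacian_mat ys H) = mat_trace (laplacian_mat xs G)"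
      using char_poly_eq_imp_mat_trace_eq car cp len by metis
    then show ?thesis
      unfolding mat_trace_laplacian_mat[OF G xs] mat_trace_laplacian_mat[OF H ys] of_int_eq_iff
      using card by (simp add: sum_subtractf V_def W_def R_def S_def)
  qed
  have "(\<Sum>x\<in>W. \<Sum>y\<in>W. (colaplacian_defect W S (int q) x y)\<^sup>2)
      = (\<Sum>x\<in>V. \<Sum>y\<in>V. (colaplacian_defect V R (int q) x y)\<^sup>2)"
  proof -
    \<comment> \<open>Holds for all \<open>s\<close> and \<open>t\<close>. Taking the coefficients
      of f, which agree for both graphs as they have equally many vertices, the constants cancel and
      the sums of squared defects remain.\<close>
    have "mat_trace (quad_mat 0 0 (quad_mat s t (laplacian_mat ys H)))
        = mat_trace (quad_mat 0 0 (quad_mat s t (laplacian_mat xs G)))" for s t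
    proof (rule char_poly_eq_imp_mat_trace_eq)
      show "char_poly (quad_mat 0 0 (quad_mat s t (laplacian_mat ys H)))
          = char_poly (quad_mat 0 0 (quad_mat s t (laplacian_mat xs G)))"
        using car len cp by (intro char_poly_quad_mat_cong[of _ "length xs"] quad_mat_carrier) auto
    qed (use car len in \<open>auto intro!: quad_mat_carrier\<close>)
    then show ?thesis
      using mat_trace_quad_mat_laplacian_mat[OF G xs, of "int q"]
        mat_trace_quad_mat_laplacian_mat[OF H ys, of "int q"] card
      unfolding V_def W_def R_def S_def by (metis add_right_cancel of_int_eq_iff)
  qed
  also have "\<dots> = 0"
    using colaplacian_defect_zero_if_equiv[OF Gp(1-3) equiv sizes]
    by (simp add: V_def R_def)
  finally have "colaplacian_defect W S (int q) x y = 0" if "x \<in> W" "y \<in> W" for x y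
    using that Hp(1) by (simp add: sum_nonneg_eq_0_iff sum_nonneg W_def)
  then have H_equiv: "equiv W S"
    and H_sizes: "\<And>x. x \<in> W \<Longrightarrow> card (S `` {x}) = 1 \<or> card (S `` {x}) = q"
    using equiv_if_colaplacian_defect_zero[OF Hp] unfolding W_def S_def by metis+
  obtain h where "bij_betw h W V" "\<And>x y. x \<in> W \<Longrightarrow> y \<in> W \<Longrightarrow> (h x, h y) \<in> R \<longleftrightarrow> (x, y) \<in> S"
  proof (rule equiv_iso_if_class_sizes_eq)
    show "card {x \<in> W. card (S `` {x}) = k} = card {x \<in> V. card (R `` {x}) = k}" for k
    proof (rule card_fibre_eq_if_sum_eq[where q = q])
      show "(\<Sum>x\<in>W. int (card (S `` {x}))) = (\<Sum>x\<in>V. int (card (R `` {x})))" by (rule tr)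
    qed (use Gp(1) Hp(1) card sizes H_sizes in \<open>auto simp: V_def W_def R_def\<close>)
  qed (use Gp(1) Hp(1) equiv H_equiv in \<open>auto simp: V_def W_def R_def\<close>)
  \<comment> \<open>A bijection that preserves and reflects nonadjacency does the same for
    adjacency.\<close>
  then show ?thesis
    using digraph_iso_with_projI[OF H G, of h] bij_betwE[of h W V]
    by (auto simp: V_def W_def R_def S_def nonadjacency_def)
qed


section \<open>The Cayley graph of the units modulo a prime power\<close>

text \<open>The interval splits into \<open>k\<close> blocks of length \<open>p\<close>, each
  containing one representative, namely \<open>r + p * i\<close> in block \<open>i\<close>.\<close>

lemma card_residue_class_mod:
  fixes p k :: nat and a :: int
  assumes "p > 0"
  shows "card {y \<in> {0..<int (p * k)}. y mod int p = a mod int p} = k"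
proof -
  define r where "r = a mod int p"
  have r: "0 \<le> r" "r < int p" using assms by (simp_all add: r_def)
  have "bij_betw (\<lambda>i. r + int p * int i) {..<k} {y \<in> {0..<int (p * k)}. y mod int p = r}"
  proof (rule bij_betw_byWitness[where f' = "\<lambda>y. nat (y div int p)"])
    show "\<forall>i\<in>{..<k}. nat ((r + int p * int i) div int p) = i"
      using r by simp
    show "\<forall>y\<in>{y \<in> {0..<int (p * k)}. y mod int p = r}. r + int p * int (nat (y div int p)) = y"
      using assms by (auto simp: pos_imp_zdiv_nonneg_iff)
    show "(\<lambda>i. r + int p * int i) ` {..<k} \<subseteq> {y \<in> {0..<int (p * k)}. y mod int p = r}"
    proof safe
      fix i assume "i < k"
      then have "int p * (int i + 1) \<le> int p * int k" by (intro mult_left_mono) auto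
      then show "r + int p * int i \<in> {0..<int (p * k)}" using r by (simp add: algebra_simps)
      show "(r + int p * int i) mod int p = r" using r by simp
    qed
    show "(\<lambda>y. nat (y div int p)) ` {y \<in> {0..<int (p * k)}. y mod int p = r} \<subseteq> {..<k}"
    proof safe
      fix y assume y: "y \<in> {0..<int (p * k)}"
      have "int p * (y div int p) \<le> y"
        using mult_div_mod_eq[of "int p" y] pos_mod_sign[of "int p" y] assms by linarith
      also have "y < int p * int k" using y by simp
      finally have "y div int p < int k" using assms by simp
      then show "nat (y div int p) < k"
        using y assms by (simp add: nat_less_iff pos_imp_zdiv_nonneg_iff)
    qed
  qed
  then show ?thesis using bij_betw_same_card r_def by fastforce
qed

theorem proposition3p4:
  fixes p m n v :: nat
    and S :: "int set"
    and \<Gamma> :: "int pair_pre_digraph"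
    and K :: "'a pair_pre_digraph"
  assumes "prime p" and "m \<ge> 1" and "n = p ^ m"
    and "S = {a \<in> carrier (integer_mod_group n). gcd a (int n) = 1}"
    and "\<Gamma> = cayley_graph (integer_mod_group n) S"
    and "v \<ge> 1" and "complete_digraph v (with_proj K)"
  shows "DS_laplacian TYPE('b) (K \<nabla> \<Gamma>)"
proof -
  \<comment> \<open>The size of a residue class modulo \<open>p\<close> inside Z_n; these classes
    are the independent parts of \<Gamma>.\<close>
  define q where "q = p ^ (m - 1)"
  have n: "n = p * q" using assms(2,3) by (cases m) (auto simp: q_def)
  have p: "p > 1" using assms(1) prime_gt_1_nat by blast
  have n1: "n > 1" using one_less_power[OF p, of m] assms(2,3) by simp
  have prime_p: "prime (int p)" using assms(1) by simp
  have carrier: "carrier (integer_mod_group n) = {0..<int n}"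
    using n1 by (simp add: carrier_integer_mod_group)
  \<comment> \<open>Reduction modulo \<open>n\<close> preserves coprimality to \<open>n\<close>, and
    for \<open>m \<ge> 1\<close> coprimality to \<open>p ^ m\<close> is coprimality to
    \<open>p\<close>. Allowing any integer \<open>a\<close> lets differences and negatives be
    inserted directly.\<close>
  have S_iff: "a mod int n \<in> S \<longleftrightarrow> \<not> int p dvd a" for a
  proof -
    have "a mod int n \<in> carrier (integer_mod_group n)"
      using n1 by (simp add: carrier)
    then have "a mod int n \<in> S \<longleftrightarrow> coprime (a mod int n) (int n)"
      by (simp add: assms(4) coprime_iff_gcd_eq_1)
    also have "\<dots> \<longleftrightarrow> coprime a (int n)"
      using n1 by (intro coprime_mod_left_iff) simp
    also have "\<dots> \<longleftrightarrow> coprime (int p) a"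
      using assms(2) unfolding assms(3) by (simp add: coprime_commute)
    also have "\<dots> \<longleftrightarrow> \<not> int p dvd a"
      using prime_imp_coprime[OF prime_p, of a] coprime_absorb_left[of "int p" a] p by auto
    finally show ?thesis .
  qed
  \<comment> \<open>Adjacency in \<Gamma> means different residues modulo \<open>p\<close>, so
    \<Gamma> is complete multipartite.\<close>
  have \<Gamma>_arcs: "parcs \<Gamma> = {(x, y). x \<in> {0..<int n} \<and> y \<in> {0..<int n} \<and> x mod int p \<noteq> y mod int p}"
  proof -
    have "inv\<^bsub>integer_mod_group n\<^esub> x \<otimes>\<^bsub>integer_mod_group n\<^esub> y \<in> S \<longleftrightarrow> x mod int p \<noteq> y mod int p"
      if "x \<in> {0..<int n}" "y \<in> {0..<int n}" for x y
    proof -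
      have eq: "inv\<^bsub>integer_mod_group n\<^esub> x \<otimes>\<^bsub>integer_mod_group n\<^esub> y = (y - x) mod int n"
        using that by (simp add: carrier mod_add_left_eq)
      show ?thesis unfolding eq S_iff mod_eq_dvd_iff by (simp add: dvd_diff_commute)
    qed
    moreover have "parcs \<Gamma> = {(x, y). x \<in> {0..<int n} \<and> y \<in> {0..<int n}
        \<and> inv\<^bsub>integer_mod_group n\<^esub> x \<otimes>\<^bsub>integer_mod_group n\<^esub> y \<in> S}"
      by (simp only: assms(5) cayley_graph_def carrier pair_pre_digraph.simps)
    ultimately show ?thesis by blast
  qed
  have \<Gamma>_verts: "pverts \<Gamma> = {0..<int n}" by (simp add: assms(5) cayley_graph_def carrier)
  have "pair_graph \<Gamma>"
    unfolding assms(5)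
  proof (rule pair_graph_cayley_graph)
    show "\<one>\<^bsub>integer_mod_group n\<^esub> \<notin> S" using S_iff[of 0] by simp
    fix h assume h: "h \<in> S"
    then have "h \<in> carrier (integer_mod_group n)" "h mod int n = h" by (auto simp: assms(4) carrier)
    then show "inv\<^bsub>integer_mod_group n\<^esub> h \<in> S" using h S_iff[of h] S_iff[of "- h"] by simp
  qed (auto simp: carrier assms(4))
  with pair_graphI_complete[OF assms(7)] have graph: "pair_graph (K \<nabla> \<Gamma>)"
    by (rule pair_graph_graph_join)
  have K_arcs: "parcs K = {(u, v). u \<in> pverts K \<and> v \<in> pverts K \<and> u \<noteq> v}"
    using assms(7) unfolding complete_digraph_pair_def by auto
  \<comment> \<open>The join adds no nonadjacent pairs across the two sides: the vertices of
    \<open>K\<close> become singleton classes, those of \<Gamma> form residue classes.\<close>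
  have R: "nonadjacency (K \<nabla> \<Gamma>) = {(Inl x, Inl x) | x. x \<in> pverts K}
      \<union> {(Inr x, Inr y) | x y. x \<in> {0..<int n} \<and> y \<in> {0..<int n} \<and> x mod int p = y mod int p}"
    by (auto simp: nonadjacency_def graph_join_def K_arcs \<Gamma>_arcs \<Gamma>_verts)
  have verts: "pverts (K \<nabla> \<Gamma>) = pverts K <+> {0..<int n}"
    by (simp add: graph_join_def \<Gamma>_verts)
  have "equiv (pverts (K \<nabla> \<Gamma>)) (nonadjacency (K \<nabla> \<Gamma>))"
    unfolding R verts by (intro equivI) (auto simp: refl_on_def sym_def trans_def)
  moreover have "card (nonadjacency (K \<nabla> \<Gamma>) `` {x}) = 1 \<or> card (nonadjacency (K \<nabla> \<Gamma>) `` {x}) = q"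
    if "x \<in> pverts (K \<nabla> \<Gamma>)" for x
  proof (cases x)
    case (Inl u)
    then have "nonadjacency (K \<nabla> \<Gamma>) `` {x} = {x}" using that by (auto simp: R verts)
    then show ?thesis by simp
  next
    case (Inr u)
    then have "nonadjacency (K \<nabla> \<Gamma>) `` {x} = Inr ` {y \<in> {0..<int (p * q)}. y mod int p = u mod int p}"
      using that by (auto simp: R verts n)
    then have "card (nonadjacency (K \<nabla> \<Gamma>) `` {x}) = q"
      using p by (simp only: card_image inj_Inr card_residue_class_mod)
    then show ?thesis ..
  qed
  ultimately show ?thesis
    unfolding DS_laplacian_def
    using laplacian_spectrum_determines_multipartite[OF graph] by blast
qed

end
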